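(* Let $\mathcal{X}\subseteq\mathbb{R}^d$ with $|\mathcal{X}|=n$ and let $\mu^1,\ldots,\mu^k\in\mathbb{R}^d$ be reference centers. If ExKMC, run on $\mathcal{X}$ with these reference centers, builds a tree $T$ with $n$ leaves, then it exactly matches the reference clustering (the clustering induced by $T$ with the surrogate cost labeling is the reference clustering), and the surrogate cost is equal to the reference cost: $$\widetilde{\mathrm{cost}}^{\mu^1,\ldots,\mu^k}(T)=\sum_{x\in\mathcal{X}}\min_{j\in[k]}\|x-\mu^j\|_2^2 .$$
   Context: A threshold tree $T$ is a binary tree in which each internal node carries a pair $(i,\theta)$ with $i\in[d]$, $\theta\in\mathbb{R}$; a point $x$ goes left if $x_i\le\theta$ and right otherwise. A labeling $\ell:\mathrm{leaves}(T)\to[k]$ induces the clustering of $\mathcal{X}$ whose $j$-th cluster is the set of points reaching a leaf labeled $j$. Reference clustering: the reference centers are obtained from a standard $k$-means algorithm, and the $j$-th cluster is the set of points $x\in\mathcal{X}$ whose closest reference center is $\mu^j$; its cost (the reference cost) is $\sum_{x\in\mathcal{X}}\min_j\|x-\mu^j\|_2^2$. Surrogate cost: if the leaves of $T$ partition $\mathcal{X}$ into $\widehat C^1,\ldots,\widehat C^m$, then $\widetilde{\mathrm{cost}}^{\mu^1,\ldots,\mu^k}(T)=\sum_{j=1}^m\min_{i\in[k]}\sum_{x\in\widehat C^j}\|x-\mu^i\|_2^2$. Surrogate cost labeling: a leaf with point set $A$ is labeled by $\arg\min_{i\in[k]}\sum_{x\in A}\|x-\mu^i\|_2^2$. ExKMC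 algorithm. Input: $\mathcal{X}$, $\mu^1,\ldots,\mu^k$, a base threshold tree (possibly empty, i.e. a single leaf), target number of leaves $k'$. Write $\widetilde{\mathrm{cost}}(A)=\min_{i\in[k]}\sum_{x\in A}\|x-\mu^i\|_2^2$. While the tree has fewer than $k'$ leaves: the gain of a leaf with point set $A$ is $\widetilde{\mathrm{cost}}(A)-\min_{i,\theta}\big(\widetilde{\mathrm{cost}}(A_L)+\widetilde{\mathrm{cost}}(A_R)\big)$, where $A_L=\{x\in A:x_i\le\theta\}$ and $A_R=\{x\in A:x_i>\theta\}$; the leaf with largest gain is replaced by an internal node with its best split and two new leaf children.
   Formalization: Every leaf of the base tree is assumed to contain a point of X, and ties among best splits are never resolved by a split sending all points to one side (otherwise the claim can fail); closest center and surrogate labels use one common tie-breaking rule. *)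

theory Defs
  imports "HOL-Analysis.Analysis"
begin

datatype 'd threshold_tree =
  Leaf
| Node 'd real "'d threshold_tree" "'d threshold_tree"

datatype side = L | R

text \<open>A leaf is identified with the path leading to it from the root.\<close>

primrec leaves :: "'d threshold_tree \<Rightarrow> side list set" where
  "leaves Leaf = {[]}"
| "leaves (Node i \<theta> l r) = (#) L ` leaves l \<union> (#) R ` leaves r"

primrec reached_leaf :: "'d::finite threshold_tree \<Rightarrow> real ^ 'd \<Rightarrow> side list" where
  "reached_leaf Leaf x = []"
| "reached_leaf (Node i \<theta> l r) x =
     (if x $ i \<le> \<theta> then L # reached_leaf l x else R # reached_leaf r x)"

definition leaf_points ::
  "(real ^ 'd) set \<Rightarrow> 'd::finite threshold_tree \<Rightarrow> side list \<Rightarrow> (real ^ 'd) set" where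
  "leaf_points X T p = {x \<in> X. reached_leaf T x = p}"

fun split_leaf ::
  "'d threshold_tree \<Rightarrow> side list \<Rightarrow> 'd \<Rightarrow> real \<Rightarrow> 'd threshold_tree" where
  "split_leaf Leaf [] i \<theta> = Node i \<theta> Leaf Leaf"
| "split_leaf (Node j \<eta> l r) (L # p) i \<theta> = Node j \<eta> (split_leaf l p i \<theta>) r"
| "split_leaf (Node j \<eta> l r) (R # p) i \<theta> = Node j \<eta> l (split_leaf r p i \<theta>)"
| "split_leaf T _ _ _ = T"

definition induced_cluster ::
  "(real ^ 'd) set \<Rightarrow> 'd::finite threshold_tree \<Rightarrow> (side list \<Rightarrow> nat) \<Rightarrow> nat \<Rightarrow> (real ^ 'd) set" where
  "induced_cluster X T lab j = {x \<in> X. lab (reached_leaf T x) = j}"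

text \<open>
  Minimizers need not be unique. A tie-breaking rule \<open>tb\<close> selects one index from every nonempty
  set of tied indices (\<open>Min\<close>, for instance, selects the smallest one). The reference
  clustering and the surrogate cost labeling use the same rule; otherwise they could disagree on
  a point equidistant from two centers.
\<close>

definition tie_breaking :: "nat \<Rightarrow> (nat set \<Rightarrow> nat) \<Rightarrow> bool" where
  "tie_breaking k tb \<longleftrightarrow> (\<forall>S. S \<noteq> {} \<and> S \<subseteq> {1..k} \<longrightarrow> tb S \<in> S)"

definition argmin_index :: "(nat set \<Rightarrow> nat) \<Rightarrow> nat \<Rightarrow> (nat \<Rightarrow> real) \<Rightarrow> nat" where
  "argmin_index tb k f = tb {i. is_arg_min f (\<lambda>i. i \<in> {1..k}) i}"

definition reference_cluster ::
  "(nat set \<Rightarrow> nat) \<Rightarrow> (real ^ 'd) set \<Rightarrow> nat \<Rightarrow> (nat \<Rightarrow> real ^ 'd) \<Rightarrow> nat \<Rightarrow> (real ^ 'd::finite) set" where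
  "reference_cluster tb X k \<mu> j = {x \<in> X. argmin_index tb k (\<lambda>i. norm (x - \<mu> i)) = j}"

definition reference_cost ::
  "(real ^ 'd::finite) set \<Rightarrow> nat \<Rightarrow> (nat \<Rightarrow> real ^ 'd) \<Rightarrow> real" where
  "reference_cost X k \<mu> = (\<Sum>x\<in>X. MIN j\<in>{1..k}. (norm (x - \<mu> j))\<^sup>2)"

definition center_cost :: "(nat \<Rightarrow> real ^ 'd::finite) \<Rightarrow> (real ^ 'd) set \<Rightarrow> nat \<Rightarrow> real" where
  "center_cost \<mu> A i = (\<Sum>x\<in>A. (norm (x - \<mu> i))\<^sup>2)"

definition set_cost :: "nat \<Rightarrow> (nat \<Rightarrow> real ^ 'd::finite) \<Rightarrow> (real ^ 'd) set \<Rightarrow> real" where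
  "set_cost k \<mu> A = (MIN i\<in>{1..k}. center_cost \<mu> A i)"

definition surrogate_cost ::
  "(real ^ 'd) set \<Rightarrow> nat \<Rightarrow> (nat \<Rightarrow> real ^ 'd) \<Rightarrow> 'd::finite threshold_tree \<Rightarrow> real" where
  "surrogate_cost X k \<mu> T = (\<Sum>p\<in>leaves T. set_cost k \<mu> (leaf_points X T p))"

definition surrogate_labeling ::
  "(nat set \<Rightarrow> nat) \<Rightarrow> (real ^ 'd) set \<Rightarrow> nat \<Rightarrow> (nat \<Rightarrow> real ^ 'd) \<Rightarrow> 'd::finite threshold_tree
    \<Rightarrow> side list \<Rightarrow> nat" where
  "surrogate_labeling tb X k \<mu> T p = argmin_index tb k (center_cost \<mu> (leaf_points X T p))"

definition left_points :: "(real ^ 'd::finite) set \<Rightarrow> 'd \<Rightarrow> real \<Rightarrow> (real ^ 'd) set" where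
  "left_points A i \<theta> = {x \<in> A. x $ i \<le> \<theta>}"

definition right_points :: "(real ^ 'd::finite) set \<Rightarrow> 'd \<Rightarrow> real \<Rightarrow> (real ^ 'd) set" where
  "right_points A i \<theta> = {x \<in> A. x $ i > \<theta>}"

definition split_cost ::
  "nat \<Rightarrow> (nat \<Rightarrow> real ^ 'd::finite) \<Rightarrow> (real ^ 'd) set \<Rightarrow> 'd \<times> real \<Rightarrow> real" where
  "split_cost k \<mu> A = (\<lambda>(i, \<theta>). set_cost k \<mu> (left_points A i \<theta>) + set_cost k \<mu> (right_points A i \<theta>))"

text \<open>
  For finite \<open>A\<close> only finitely many pairs of parts arise from splitting, so the minimum over
  all coordinates and all real thresholds exists.
\<close>

definition gain :: "nat \<Rightarrow> (nat \<Rightarrow> real ^ 'd::finite) \<Rightarrow> (real ^ 'd) set \<Rightarrow> real" where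
  "gain k \<mu> A = set_cost k \<mu> A - Min (range (split_cost k \<mu> A))"

text \<open>
  The leaf and its split are arbitrary maximizers and minimizers, except that ties are never
  resolved in favour of a split sending all points of the leaf to the same child. This only
  restricts ties: if \<open>A\<close> has at least two points, some split with both parts nonempty attains
  the minimum, because splitting never increases the cost; if \<open>A\<close> has at most one point, its
  gain is zero, which is the least possible gain. Hence a step exists whenever the tree has fewer
  leaves than there are points. Degenerate splits at zero gain would allow trees with as many leaves
  as points in which some leaves are empty and others mix points of different reference clusters.
\<close>

inductive exkmc_step ::
  "(real ^ 'd) set \<Rightarrow> nat \<Rightarrow> (nat \<Rightarrow> real ^ 'd) \<Rightarrow> 'd::finite threshold_tree \<Rightarrow> 'd threshold_tree \<Rightarrow> bool"
  for X k \<mu> where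
  "\<lbrakk> is_arg_max (\<lambda>q. gain k \<mu> (leaf_points X T q)) (\<lambda>q. q \<in> leaves T) p;
     is_arg_min (split_cost k \<mu> (leaf_points X T p)) (\<lambda>_. True) (i, \<theta>);
     left_points (leaf_points X T p) i \<theta> \<noteq> {};
     right_points (leaf_points X T p) i \<theta> \<noteq> {} \<rbrakk>
   \<Longrightarrow> exkmc_step X k \<mu> T (split_leaf T p i \<theta>)"

text \<open>\<open>T\<close> is a possible output on the base tree \<open>T\<^sub>0\<close> with target number \<open>k'\<close> of leaves.\<close>

definition exkmc ::
  "(real ^ 'd) set \<Rightarrow> nat \<Rightarrow> (nat \<Rightarrow> real ^ 'd) \<Rightarrow> 'd threshold_tree \<Rightarrow> nat
    \<Rightarrow> 'd::finite threshold_tree \<Rightarrow> bool" where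
  "exkmc X k \<mu> T\<^sub>0 k' T \<longleftrightarrow>
     (\<lambda>S S'. card (leaves S) < k' \<and> exkmc_step X k \<mu> S S')\<^sup>*\<^sup>* T\<^sub>0 T \<and> \<not> card (leaves T) < k'"

end

theory Submission
  imports Defs
begin

text \<open>
  No step of the algorithm creates an empty leaf, so every leaf of the final tree is reached by a
  point of \<open>X\<close>. Hence if there are as many leaves as points, every leaf contains exactly one
  point, and its best single center is the center closest to that point.
\<close>

lemma finite_leaves [simp]: "finite (leaves T)"
  by (induction T) auto

lemma reached_leaf_in_leaves: "reached_leaf T x \<in> leaves T"
  by (induction T) auto

text \<open>The hypothesis on \<open>p\<close> matters: \<open>split_leaf\<close> returns the tree
  unchanged when \<open>p\<close> is not the path of a leaf.\<close>

lemma leaves_split_leaf: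
  assumes "p \<in> leaves T"
  shows "leaves (split_leaf T p i \<theta>) = leaves T - {p} \<union> {p @ [L], p @ [R]}"
  using assms by (induction T p i \<theta> rule: split_leaf.induct) auto

lemma reached_leaf_split_leaf:
  assumes "p \<in> leaves T"
  shows "reached_leaf (split_leaf T p i \<theta>) x =
    (if reached_leaf T x = p then p @ [if x $ i \<le> \<theta> then L else R] else reached_leaf T x)"
  using assms by (induction T p i \<theta> rule: split_leaf.induct) auto

text \<open>Having no empty leaf is carried along as an equation of sets, since this form yields
  injectivity by counting and lets sums over leaves be reindexed by points.\<close>

lemma leaves_eq_image_iff:
  "reached_leaf T ` X = leaves T \<longleftrightarrow> (\<forall>p\<in>leaves T. leaf_points X T p \<noteq> {})"
proof -
  have "reached_leaf T ` X \<subseteq> leaves T"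
    using reached_leaf_in_leaves by blast
  moreover have "leaf_points X T p \<noteq> {} \<longleftrightarrow> p \<in> reached_leaf T ` X" for p
    by (auto simp: leaf_points_def)
  ultimately show ?thesis by blast
qed

text \<open>Points outside the split leaf keep their leaf, and both new leaves receive a point
  because a step excludes degenerate splits.\<close>

lemma exkmc_step_leaves_eq_image:
  assumes "exkmc_step X k \<mu> T T'" and img: "reached_leaf T ` X = leaves T"
  shows "reached_leaf T' ` X = leaves T'"
  using assms(1)
proof cases
  case (1 p i \<theta>)
  have p: "p \<in> leaves T"
    using 1(2) by (simp add: is_arg_max_def)
  \<comment> \<open>\<open>x\<close> and \<open>y\<close> will occupy the left and the right child
    of \<open>p\<close>.\<close>
  obtain x y where x: "x \<in> X" "reached_leaf T x = p" "x $ i \<le> \<theta>"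
    and y: "y \<in> X" "reached_leaf T y = p" "\<not> y $ i \<le> \<theta>"
    using 1(4,5) by (auto simp: left_points_def right_points_def leaf_points_def)
  have "q \<in> reached_leaf T' ` X" if q: "q \<in> leaves T'" for q
  proof -
    consider "q \<in> leaves T" "q \<noteq> p" | "q = p @ [L]" | "q = p @ [R]"
      using q 1(1) leaves_split_leaf[OF p] by auto
    then show ?thesis
    proof cases
      case 1
      then obtain z where "z \<in> X" "reached_leaf T z = q"
        unfolding img[symmetric] by blast
      with 1 \<open>T' = _\<close> show ?thesis
        by (intro image_eqI[of _ _ z]) (simp_all add: reached_leaf_split_leaf[OF p])
    next
      case 2
      with x \<open>T' = _\<close> show ?thesis
        by (intro image_eqI[of _ _ x]) (simp_all add: reached_leaf_split_leaf[OF p])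
    next
      case 3
      with y \<open>T' = _\<close> show ?thesis
        by (intro image_eqI[of _ _ y]) (simp_all add: reached_leaf_split_leaf[OF p])
    qed
  qed
  then show ?thesis
    using reached_leaf_in_leaves by blast
qed

lemma exkmc_leaves_eq_image:
  assumes "exkmc X k \<mu> T\<^sub>0 k' T" and img: "reached_leaf T\<^sub>0 ` X = leaves T\<^sub>0"
  shows "reached_leaf T ` X = leaves T"
proof -
  have "(\<lambda>S S'. card (leaves S) < k' \<and> exkmc_step X k \<mu> S S')\<^sup>*\<^sup>* T\<^sub>0 T"
    using assms(1) by (simp add: exkmc_def)
  then show ?thesis
  proof induction
    case base
    show ?case by (fact img)
  next
    case (step S S')
    then show ?case by (intro exkmc_step_leaves_eq_image[of X k \<mu> S S']) simp_all
  qed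
qed

text \<open>Squaring preserves the order of nonnegative reals, so both functions have the same set
  of minimizers and \<open>tb\<close> picks the same index. This bridges distances in the reference
  clustering and squared distances in the surrogate cost.\<close>

lemma argmin_index_power2:
  fixes f :: "nat \<Rightarrow> real"
  assumes "\<And>i. f i \<ge> 0"
  shows "argmin_index tb k (\<lambda>i. (f i)\<^sup>2) = argmin_index tb k f"
proof -
  have "(f i)\<^sup>2 < (f j)\<^sup>2 \<longleftrightarrow> f i < f j" for i j
    using power_strict_mono[of "f i" "f j" 2] power2_less_imp_less[of "f i" "f j"] assms by auto
  then show ?thesis
    by (simp add: argmin_index_def is_arg_min_def)
qed

text \<open>The condition on the base tree holds for a single leaf when \<open>X\<close> is
  nonempty. An empty base leaf would never be split, so a final tree with \<open>n\<close> leaves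
  would have a leaf with several points.\<close>

theorem corollary2:
  fixes X :: "(real ^ 'd::finite) set"
    and \<mu> :: "nat \<Rightarrow> real ^ 'd"
    and n k k' :: nat
    and T\<^sub>0 T :: "'d threshold_tree"
    and tb :: "nat set \<Rightarrow> nat"
  assumes "finite X" and "card X = n"
    and "k \<ge> 1"
    and "tie_breaking k tb"
    and base: "\<forall>p\<in>leaves T\<^sub>0. leaf_points X T\<^sub>0 p \<noteq> {}"
    and "exkmc X k \<mu> T\<^sub>0 k' T"
    and "card (leaves T) = n"
  shows "(\<forall>j\<in>{1..k}. induced_cluster X T (surrogate_labeling tb X k \<mu> T) j
                        = reference_cluster tb X k \<mu> j)
       \<and> surrogate_cost X k \<mu> T = reference_cost X k \<mu>"
proof -
  have img: "reached_leaf T ` X = leaves T"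
    using exkmc_leaves_eq_image[OF \<open>exkmc X k \<mu> T\<^sub>0 k' T\<close>] base leaves_eq_image_iff by blast
  \<comment> \<open>The image of the finite set \<open>X\<close> has \<open>n\<close> elements, as
    many as \<open>X\<close> itself.\<close>
  then have inj: "inj_on (reached_leaf T) X"
    using assms(1,2,7) by (simp add: eq_card_imp_inj_on)
  then have single: "leaf_points X T (reached_leaf T x) = {x}" if "x \<in> X" for x
    using that by (auto simp: leaf_points_def dest: inj_onD)
  \<comment> \<open>On the singleton leaf of \<open>x\<close>, \<open>center_cost\<close> is just
    the squared distance from \<open>x\<close>.\<close>
  have "surrogate_labeling tb X k \<mu> T (reached_leaf T x)
      = argmin_index tb k (\<lambda>i. norm (x - \<mu> i))" if "x \<in> X" for x
    by (simp add: surrogate_labeling_def single[OF that] center_cost_def[abs_def]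
        argmin_index_power2)
  then have "induced_cluster X T (surrogate_labeling tb X k \<mu> T) j
      = reference_cluster tb X k \<mu> j" for j
    by (auto simp: induced_cluster_def reference_cluster_def)
  \<comment> \<open>The bijection between points and leaves turns the sum over leaves into a sum
    over \<open>X\<close>.\<close>
  moreover have "surrogate_cost X k \<mu> T = reference_cost X k \<mu>"
    by (simp add: surrogate_cost_def reference_cost_def img[symmetric] sum.reindex[OF inj]
        single set_cost_def center_cost_def)
  ultimately show ?thesis by blast
qed

end
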